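(* Let $\mathfrak m_2$ be the infinite dimensional $\mathbb N$-graded Lie algebra over $\mathbb K$ ($\mathbb K=\mathbb R$ or $\mathbb C$) with basis $(e_i)_{i\ge 1}$ and only non-trivial brackets (up to antisymmetry) $[e_1,e_i]=e_{i+1}$ for $i\ge 2$ and $[e_2,e_j]=e_{j+2}$ for $j\ge 3$. For $l\in\mathbb Z$ let $H^1_l(\mathfrak m_2,\mathfrak m_2)$ be the weight $l$ part of its first adjoint cohomology. Then $$\dim H^1_l(\mathfrak m_2,\mathfrak m_2)=\begin{cases}0 & \text{if } l=1 \text{ or } l\le -1,\\ 1 & \text{if } l=0 \text{ or } l\ge 2.\end{cases}$$
   Context: Cohomology is Lie algebra cohomology with coefficients in the adjoint representation. A $1$-cochain $\omega$ is homogeneous of weight $l\in\mathbb Z$ if $\omega(e_i)=a_ie_{i+l}$ with $a_i\in\mathbb K$ for all $i\ge 1$ (with $e_k:=0$ for $k\le 0$). $H^1_l$ is the quotient of the homogeneous $1$-cocycles of weight $l$ (derivations) by the homogeneous $1$-coboundaries of weight $l$ (multiples of $[e_l,-]$ for $l\ge 1$, and $0$ for $l\le 0$). *)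

theory Defs
  imports
    "HOL-Library.Poly_Mapping"
    "HOL-Algebra.AbelCoset"
    "Jordan_Normal_Form.VS_Connect"
begin

section \<open>Quotient modules\<close>

text \<open>
  The quotient of a module \<open>M\<close> by a submodule \<open>N\<close>: cosets of \<open>N\<close>, added as in
  \<^const>\<open>FactGroup\<close>. Taking the union of the cosets \<open>N + c x\<close> over \<open>x \<in> X\<close> makes
  \<open>0 \<odot> X = N\<close>. The multiplicative fields of the record play no role for modules.
\<close>

definition quotient_module :: "('a, 'b, 'c) module_scheme \<Rightarrow> 'b set \<Rightarrow> ('a, 'b set) module" where
  "quotient_module M N =
     \<lparr> carrier = a_rcosets\<^bsub>M\<^esub> N, mult = undefined, one = undefined,
       zero = N, add = set_add M,
       smult = (\<lambda>c X. \<Union>x\<in>X. N +>\<^bsub>M\<^esub> (c \<odot>\<^bsub>M\<^esub> x)) \<rparr>"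

section \<open>The Lie algebra\<close>

text \<open>
  The underlying vector space is the space of finitely supported functions on the naturals.
  The basis is \<open>e 1, e 2, \<dots>\<close>, so the coordinate with index \<open>n\<close> is the coefficient of
  \<open>e (n + 1)\<close>. Basis vectors are indexed by integers in order to allow negative weights.
\<close>

type_synonym 'k m2 = "nat \<Rightarrow>\<^sub>0 'k"

definition m2_scale :: "'k::field \<Rightarrow> 'k m2 \<Rightarrow> 'k m2" where
  "m2_scale c x = Poly_Mapping.map ((*) c) x"

definition m2_e :: "int \<Rightarrow> 'k::field m2" where
  "m2_e k = (if k \<ge> 1 then Poly_Mapping.single (nat (k - 1)) 1 else 0)"

definition m2_basis_bracket :: "int \<Rightarrow> int \<Rightarrow> 'k::field m2" where
  "m2_basis_bracket i j =
     (if i = 1 \<and> j \<ge> 2 then m2_e (j + 1)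
      else if i \<ge> 2 \<and> j = 1 then - m2_e (i + 1)
      else if i = 2 \<and> j \<ge> 3 then m2_e (j + 2)
      else if i \<ge> 3 \<and> j = 2 then - m2_e (i + 2)
      else 0)"

definition m2_bracket :: "'k::field m2 \<Rightarrow> 'k m2 \<Rightarrow> 'k m2" where
  "m2_bracket x y =
     (\<Sum>m\<in>Poly_Mapping.keys x. \<Sum>n\<in>Poly_Mapping.keys y.
        m2_scale (Poly_Mapping.lookup x m * Poly_Mapping.lookup y n)
          (m2_basis_bracket (int m + 1) (int n + 1)))"

section \<open>First adjoint cohomology by weight\<close>

type_synonym 'k m2_cochain = "'k m2 \<Rightarrow> 'k m2"

definition m2_cochains :: "'k::field m2_cochain set" where
  "m2_cochains = {\<omega>. Vector_Spaces.linear m2_scale m2_scale \<omega>}"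

definition m2_homogeneous :: "int \<Rightarrow> 'k::field m2_cochain \<Rightarrow> bool" where
  "m2_homogeneous l \<omega> \<longleftrightarrow> (\<forall>i\<ge>1. \<exists>a. \<omega> (m2_e i) = m2_scale a (m2_e (i + l)))"

text \<open>For adjoint coefficients the 1-cocycles are the derivations.\<close>

definition m2_cocycles :: "int \<Rightarrow> 'k::field m2_cochain set" where
  "m2_cocycles l =
     {\<omega> \<in> m2_cochains. m2_homogeneous l \<omega> \<and>
        (\<forall>x y. \<omega> (m2_bracket x y) = m2_bracket (\<omega> x) y + m2_bracket x (\<omega> y))}"

definition m2_coboundaries :: "int \<Rightarrow> 'k::field m2_cochain set" where
  "m2_coboundaries l = {\<omega>. m2_homogeneous l \<omega> \<and> (\<exists>x. \<omega> = m2_bracket x)}"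

definition m2_cocycle_space :: "int \<Rightarrow> ('k::field, 'k m2_cochain) module" where
  "m2_cocycle_space l =
     \<lparr> carrier = m2_cocycles l, mult = undefined, one = undefined,
       zero = (\<lambda>_. 0), add = (\<lambda>\<phi> \<psi> x. \<phi> x + \<psi> x), smult = (\<lambda>c \<phi> x. m2_scale c (\<phi> x)) \<rparr>"

definition m2_H1 :: "int \<Rightarrow> ('k::field, 'k m2_cochain set) module" where
  "m2_H1 l = quotient_module (m2_cocycle_space l) (m2_coboundaries l)"

section \<open>Lie algebra laws\<close>


lemma lookup_m2_scale [simp]:
  "Poly_Mapping.lookup (m2_scale c x) n = c * Poly_Mapping.lookup x n"
  by (simp add: m2_scale_def map.rep_eq when_def)

lemma vector_space_m2_scale: "vector_space (m2_scale :: 'k::field \<Rightarrow> _)"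
  by unfold_locales (auto intro!: poly_mapping_eqI simp: lookup_add algebra_simps)

interpretation m2: vector_space "m2_scale :: 'k::field \<Rightarrow> 'k m2 \<Rightarrow> 'k m2"
  by (rule vector_space_m2_scale)

lemma m2_bracket_superset:
  assumes "finite A" "finite B" "Poly_Mapping.keys x \<subseteq> A" "Poly_Mapping.keys y \<subseteq> B"
  shows "m2_bracket x y = (\<Sum>m\<in>A. \<Sum>n\<in>B.
           m2_scale (Poly_Mapping.lookup x m * Poly_Mapping.lookup y n)
             (m2_basis_bracket (int m + 1) (int n + 1)))"
proof -
  have "m2_bracket x y = (\<Sum>m\<in>Poly_Mapping.keys x. \<Sum>n\<in>B.
           m2_scale (Poly_Mapping.lookup x m * Poly_Mapping.lookup y n)
             (m2_basis_bracket (int m + 1) (int n + 1)))"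
    unfolding m2_bracket_def using assms
    by (intro sum.cong refl sum.mono_neutral_left) (auto simp: in_keys_iff)
  also have "\<dots> = (\<Sum>m\<in>A. \<Sum>n\<in>B.
           m2_scale (Poly_Mapping.lookup x m * Poly_Mapping.lookup y n)
             (m2_basis_bracket (int m + 1) (int n + 1)))"
    using assms by (intro sum.mono_neutral_left) (auto simp: in_keys_iff)
  finally show ?thesis .
qed

lemma m2_bracket_add_left: "m2_bracket (x + x') y = m2_bracket x y + m2_bracket x' y"
proof -
  let ?A = "Poly_Mapping.keys x \<union> Poly_Mapping.keys x'"
  have "Poly_Mapping.keys (x + x') \<subseteq> ?A" by (rule keys_add)
  then show ?thesis
    by (subst (1 2 3) m2_bracket_superset[where A = ?A and B = "Poly_Mapping.keys y"])
       (auto simp: lookup_add distrib_right m2.scale_left_distrib sum.distrib)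
qed

lemma m2_bracket_add_right: "m2_bracket x (y + y') = m2_bracket x y + m2_bracket x y'"
proof -
  let ?B = "Poly_Mapping.keys y \<union> Poly_Mapping.keys y'"
  have "Poly_Mapping.keys (y + y') \<subseteq> ?B" by (rule keys_add)
  then show ?thesis
    by (subst (1 2 3) m2_bracket_superset[where A = "Poly_Mapping.keys x" and B = ?B])
       (auto simp: lookup_add distrib_left m2.scale_left_distrib sum.distrib)
qed

lemma m2_bracket_scale_left: "m2_bracket (m2_scale c x) y = m2_scale c (m2_bracket x y)"
proof -
  have "Poly_Mapping.keys (m2_scale c x) \<subseteq> Poly_Mapping.keys x"
    by (auto simp: in_keys_iff)
  then show ?thesis
    by (subst (1 2) m2_bracket_superset[where A = "Poly_Mapping.keys x" and B = "Poly_Mapping.keys y"])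
       (auto simp: m2.scale_sum_right mult.assoc)
qed

lemma m2_bracket_scale_right: "m2_bracket x (m2_scale c y) = m2_scale c (m2_bracket x y)"
proof -
  have "Poly_Mapping.keys (m2_scale c y) \<subseteq> Poly_Mapping.keys y"
    by (auto simp: in_keys_iff)
  then show ?thesis
    by (subst (1 2) m2_bracket_superset[where A = "Poly_Mapping.keys x" and B = "Poly_Mapping.keys y"])
       (auto simp: m2.scale_sum_right mult.left_commute)
qed

lemma linear_m2_bracket: "Vector_Spaces.linear m2_scale m2_scale (m2_bracket x)"
  by (intro Vector_Spaces.linear.intro module_hom.intro)
     (auto intro!: module_hom_axioms.intro vector_space_m2_scale m2.module_axioms
       simp: m2_bracket_add_right m2_bracket_scale_right)

lemma m2_bracket_zero [simp]: "m2_bracket 0 y = 0" "m2_bracket x 0 = 0"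
  by (simp_all add: m2_bracket_def)

lemma m2_e_nonpos [simp]: "k \<le> 0 \<Longrightarrow> m2_e k = 0"
  by (simp add: m2_e_def)

lemma m2_bracket_e: "m2_bracket (m2_e i) (m2_e j) = m2_basis_bracket i j"
proof (cases "i \<ge> 1 \<and> j \<ge> 1")
  case True
  then show ?thesis by (simp add: m2_bracket_def m2_e_def)
next
  case False
  then show ?thesis by (auto simp: m2_basis_bracket_def not_le)
qed

lemma m2_expand:
  "x = (\<Sum>n\<in>Poly_Mapping.keys x. m2_scale (Poly_Mapping.lookup x n) (m2_e (int n + 1)))"
proof (rule poly_mapping_eqI)
  fix k
  have "(\<Sum>n\<in>Poly_Mapping.keys x. Poly_Mapping.lookup x n *
          Poly_Mapping.lookup (m2_e (int n + 1)) k)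
      = (\<Sum>n\<in>Poly_Mapping.keys x. if n = k then Poly_Mapping.lookup x n else 0)"
    by (intro sum.cong) (auto simp: m2_e_def lookup_single)
  then show "Poly_Mapping.lookup x k = Poly_Mapping.lookup
     (\<Sum>n\<in>Poly_Mapping.keys x. m2_scale (Poly_Mapping.lookup x n) (m2_e (int n + 1))) k"
    by (auto simp: lookup_sum in_keys_iff)
qed

lemma m2_induct [case_names zero add scale e]:
  assumes "P 0" "\<And>x y. P x \<Longrightarrow> P y \<Longrightarrow> P (x + y)" "\<And>c x. P x \<Longrightarrow> P (m2_scale c x)"
    "\<And>i. i \<ge> 1 \<Longrightarrow> P (m2_e i)"
  shows "P x"
proof -
  have "P (\<Sum>n\<in>A. m2_scale (Poly_Mapping.lookup x n) (m2_e (int n + 1)))" if "finite A" for A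
    using that by induction (auto intro!: assms)
  from this[of "Poly_Mapping.keys x"] show ?thesis using m2_expand[of x] by simp
qed

lemma m2_bracket_uminus: "m2_bracket (- x) y = - m2_bracket x y" "m2_bracket x (- y) = - m2_bracket x y"
  by (metis m2_bracket_scale_left m2.scale_minus_left m2.scale_one,
      metis m2_bracket_scale_right m2.scale_minus_left m2.scale_one)

lemma m2_bracket_antisym: "m2_bracket x y = - m2_bracket y x"
proof (induction x rule: m2_induct)
  case (e i)
  show ?case
    by (induction y rule: m2_induct)
      (auto simp: m2_bracket_add_left m2_bracket_add_right m2_bracket_scale_left
         m2_bracket_scale_right m2_bracket_e m2_basis_bracket_def)
qed (auto simp: m2_bracket_add_left m2_bracket_add_right m2_bracket_scale_left
   m2_bracket_scale_right)

lemma m2_bracket_self_zero: "m2_bracket x x = (0 :: 'k::field m2)"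
proof (induction x rule: m2_induct)
  case (add x y)
  then show ?case 
    using m2_bracket_antisym[of x y] by (simp add: m2_bracket_add_left m2_bracket_add_right)
qed (auto simp: m2_bracket_scale_left m2_bracket_scale_right m2_bracket_e m2_basis_bracket_def)

lemma m2_jacobi_e: 
  assumes "i \<ge> 1" "j \<ge> 1" "k \<ge> 1"
  shows "m2_bracket (m2_e i) (m2_bracket (m2_e j) (m2_e k)) + m2_bracket (m2_e j) (m2_bracket (m2_e k) (m2_e i)) +
     m2_bracket (m2_e k) (m2_bracket (m2_e i) (m2_e j)) = 0"
proof -
  have "i = 1 \<or> i = 2 \<or> i \<ge> 3" "j = 1 \<or> j = 2 \<or> j \<ge> 3" "k = 1 \<or> k = 2 \<or> k \<ge> 3"
    using assms by linarith+
  then show ?thesis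
    by (elim disjE)
       (simp_all add: m2_bracket_e m2_basis_bracket_def m2_bracket_uminus add.commute)
qed

lemma m2_jacobi:
  "m2_bracket x (m2_bracket y z) + m2_bracket y (m2_bracket z x) + m2_bracket z (m2_bracket x y) = 0"
proof -
  note s = m2_bracket_add_left m2_bracket_add_right m2_bracket_scale_left m2_bracket_scale_right
    m2.scale_right_distrib[symmetric] 
  have 1: "a + a' + (b + b') + (c + c') = 0" if "a + b + c = 0" "a' + b' + c' = 0"
    for a a' b b' c c' :: "'a m2"
    using that by (metis (no_types, opaque_lifting) add.assoc add.commute add_0)
  show ?thesis
  proof (induction x rule: m2_induct)
    case (e i) note i = this
    show ?case
    proof (induction y rule: m2_induct)
      case (e j) note j = this
      show ?case
        by (induction z rule: m2_induct) (auto intro: m2_jacobi_e i j 1 simp: s)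
    qed (auto simp: s 1)
  qed (auto simp: s 1)
qed


section \<open>The coboundaries of weight \<open>l\<close> are the multiples of the bracket with \<open>e l\<close>\<close>

lemma lookup_m2_bracket_e1:
  "Poly_Mapping.lookup (m2_bracket x (m2_e 1)) (Suc n) =
     (if n \<ge> 1 then - Poly_Mapping.lookup x n else 0)"
  by (induction x rule: m2_induct)
     (auto simp: m2_bracket_add_left m2_bracket_scale_left m2_bracket_e m2_basis_bracket_def
        lookup_add, auto simp: m2_e_def lookup_single lookup_one when_def)

lemma lookup_m2_bracket_e2:
  "Poly_Mapping.lookup (m2_bracket x (m2_e 2)) 2 = Poly_Mapping.lookup x 0"
  by (induction x rule: m2_induct)
     (auto simp: m2_bracket_add_left m2_bracket_scale_left m2_bracket_e m2_basis_bracket_def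
        lookup_add, auto simp: m2_e_def lookup_single when_def)

lemma m2_homogeneous_bracket_e: "m2_homogeneous l (m2_bracket (m2_scale c (m2_e l)))"
proof -
  have "\<exists>a. m2_basis_bracket l i = m2_scale a (m2_e (i + l))" for i
    by (rule exI[of _ "if l = 1 \<and> i \<ge> 2 \<or> l = 2 \<and> i \<ge> 3 then 1
          else if l \<ge> 2 \<and> i = 1 \<or> l \<ge> 3 \<and> i = 2 then -1 else 0"])
       (auto simp: m2_basis_bracket_def add.commute)
  then show ?thesis
    unfolding m2_homogeneous_def m2_bracket_scale_left m2_bracket_e
    by (metis m2.scale_scale)
qed

lemma m2_coboundaries_eq:
  "m2_coboundaries l = {\<omega>. \<exists>c. \<omega> = (\<lambda>y. m2_scale c (m2_bracket (m2_e l) y))}"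
proof (intro equalityI subsetI)
  fix \<omega> :: "'a m2_cochain" assume "\<omega> \<in> m2_coboundaries l"
  then obtain x where x: "\<omega> = m2_bracket x" and hom: "m2_homogeneous l (m2_bracket x)"
    by (auto simp: m2_coboundaries_def)
  from hom obtain a b where
    a: "m2_bracket x (m2_e 1) = m2_scale a (m2_e (1 + l))" and
    b: "m2_bracket x (m2_e 2) = m2_scale b (m2_e (2 + l))"
    unfolding m2_homogeneous_def by (meson one_le_numeral order_refl)
  have zero: "Poly_Mapping.lookup x n = 0" if "int n + 1 \<noteq> l" for n
  proof (cases "n = 0")
    case True
    have "Poly_Mapping.lookup x 0 = b * Poly_Mapping.lookup (m2_e (2 + l)) 2"
      using lookup_m2_bracket_e2[of x] b by simp
    with True that show ?thesis by (auto simp: m2_e_def lookup_single when_def)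
  next
    case False
    then have "- Poly_Mapping.lookup x n = a * Poly_Mapping.lookup (m2_e (1 + l)) (Suc n)"
      using lookup_m2_bracket_e1[of x n] a by simp
    with that show ?thesis by (auto simp: m2_e_def lookup_single when_def split: if_splits)
  qed
  have "x = m2_scale (Poly_Mapping.lookup x (nat (l - 1))) (m2_e l)"
  proof (rule poly_mapping_eqI)
    fix n show "Poly_Mapping.lookup x n =
        Poly_Mapping.lookup (m2_scale (Poly_Mapping.lookup x (nat (l - 1))) (m2_e l)) n"
      using zero[of n] by (auto simp: m2_e_def lookup_single when_def)
  qed
  then obtain c where "x = m2_scale c (m2_e l)" by blast
  then have "\<omega> = (\<lambda>y. m2_scale c (m2_bracket (m2_e l) y))"
    using x by (simp add: m2_bracket_scale_left fun_eq_iff)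
  then show "\<omega> \<in> {\<omega>. \<exists>c. \<omega> = (\<lambda>y. m2_scale c (m2_bracket (m2_e l) y))}"
    by blast
next
  fix \<omega> :: "'a m2_cochain"
  assume "\<omega> \<in> {\<omega>. \<exists>c. \<omega> = (\<lambda>y. m2_scale c (m2_bracket (m2_e l) y))}"
  then obtain c where "\<omega> = (\<lambda>y. m2_scale c (m2_bracket (m2_e l) y))" by blast
  then have "\<omega> = m2_bracket (m2_scale c (m2_e l))" by (auto simp: m2_bracket_scale_left)
  then show "\<omega> \<in> m2_coboundaries l"
    using m2_homogeneous_bracket_e by (auto simp: m2_coboundaries_def)
qed

lemma m2_coboundaries_subset_cocycles: "m2_coboundaries l \<subseteq> m2_cocycles l"
proof -
  have "m2_bracket x (m2_bracket y z) = m2_bracket (m2_bracket x y) z + m2_bracket y (m2_bracket x z)"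
    for x y z :: "'a m2"
    using m2_jacobi[of x y z] m2_bracket_antisym[of z x] m2_bracket_antisym[of z "m2_bracket x y"]
    by (simp add: m2_bracket_uminus algebra_simps)
  then show ?thesis
    unfolding m2_coboundaries_def m2_cocycles_def m2_cochains_def
    using linear_m2_bracket by blast
qed


section \<open>The cohomology is a vector space\<close>

lemma linear_m2_iff:
  "Vector_Spaces.linear m2_scale m2_scale f \<longleftrightarrow>
     (\<forall>x y. f (x + y) = f x + f y) \<and> (\<forall>c x. f (m2_scale c x) = m2_scale c (f x))"
  by (simp add: Vector_Spaces.linear_def module_hom_def module_hom_axioms_def
      vector_space_m2_scale m2.module_axioms)

lemma m2_homogeneous_add:
  assumes "m2_homogeneous l \<phi>" "m2_homogeneous l \<psi>"
  shows "m2_homogeneous l (\<lambda>x. \<phi> x + \<psi> x)"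
  using assms unfolding m2_homogeneous_def by (metis m2.scale_left_distrib)

lemma m2_homogeneous_scale:
  assumes "m2_homogeneous l \<phi>"
  shows "m2_homogeneous l (\<lambda>x. m2_scale c (\<phi> x))"
  using assms unfolding m2_homogeneous_def by (metis m2.scale_scale)

lemma zero_in_m2_cocycles: "(\<lambda>_. 0) \<in> m2_cocycles l"
  by (auto simp: m2_cocycles_def m2_cochains_def linear_m2_iff m2_homogeneous_def)

lemma add_in_m2_cocycles:
  "\<phi> \<in> m2_cocycles l \<Longrightarrow> \<psi> \<in> m2_cocycles l \<Longrightarrow> (\<lambda>x. \<phi> x + \<psi> x) \<in> m2_cocycles l"
  by (auto simp: m2_cocycles_def m2_cochains_def linear_m2_iff m2_homogeneous_add
      m2.scale_right_distrib m2_bracket_add_left m2_bracket_add_right ac_simps)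

lemma scale_in_m2_cocycles:
  "\<phi> \<in> m2_cocycles l \<Longrightarrow> (\<lambda>x. m2_scale c (\<phi> x)) \<in> m2_cocycles l"
  by (auto simp: m2_cocycles_def m2_cochains_def linear_m2_iff m2_homogeneous_scale
      m2.scale_right_distrib m2_bracket_scale_left m2_bracket_scale_right mult.commute)

lemma vectorspace_m2_cocycle_space:
  "vectorspace class_ring (m2_cocycle_space l :: ('k::field, 'k m2_cochain) module)"
proof -
  have "\<exists>\<psi>\<in>m2_cocycles l. (\<lambda>x. \<psi> x + \<phi> x) = (\<lambda>_. 0)" if "\<phi> \<in> m2_cocycles l" for \<phi> :: "'k m2_cochain"
    using scale_in_m2_cocycles[OF that, of "-1"] by (intro bexI) auto
  then have "abelian_group (m2_cocycle_space l :: ('k, 'k m2_cochain) module)"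
    by (intro abelian_groupI)
       (auto simp: m2_cocycle_space_def zero_in_m2_cocycles add_in_m2_cocycles add.assoc add.commute)
  then have "Module.module class_ring (m2_cocycle_space l :: ('k, 'k m2_cochain) module)"
    by (intro moduleI)
       (auto simp: m2_cocycle_space_def scale_in_m2_cocycles m2.scale_left_distrib
         m2.scale_right_distrib class_cring.is_cring)
  then show ?thesis
    by (simp add: vectorspace_def class_field)
qed

lemma submodule_m2_coboundaries:
  "submodule class_ring (m2_coboundaries l) (m2_cocycle_space l :: ('k::field, 'k m2_cochain) module)"
proof (rule submodule.intro)
  show "Module.module class_ring (m2_cocycle_space l :: ('k, 'k m2_cochain) module)"
    using vectorspace_m2_cocycle_space vectorspace_def by blast
next
  show "m2_coboundaries l \<subseteq> carrier (m2_cocycle_space l :: ('k, 'k m2_cochain) module)"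
    using m2_coboundaries_subset_cocycles by (auto simp: m2_cocycle_space_def)
next
  fix v w :: "'k m2_cochain" assume "v \<in> m2_coboundaries l" "w \<in> m2_coboundaries l"
  then obtain a b where "v = (\<lambda>y. m2_scale a (m2_bracket (m2_e l) y))"
      "w = (\<lambda>y. m2_scale b (m2_bracket (m2_e l) y))"
    unfolding m2_coboundaries_eq by blast
  then have "v \<oplus>\<^bsub>m2_cocycle_space l\<^esub> w = (\<lambda>y. m2_scale (a + b) (m2_bracket (m2_e l) y))"
    by (simp add: m2_cocycle_space_def m2.scale_left_distrib)
  then show "v \<oplus>\<^bsub>m2_cocycle_space l\<^esub> w \<in> m2_coboundaries l"
    unfolding m2_coboundaries_eq by blast
next
  have "\<zero>\<^bsub>m2_cocycle_space l\<^esub> = (\<lambda>y. m2_scale 0 (m2_bracket (m2_e l) y :: 'k m2))"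
    by (simp add: m2_cocycle_space_def)
  then show "\<zero>\<^bsub>m2_cocycle_space l\<^esub> \<in> (m2_coboundaries l :: 'k m2_cochain set)"
    unfolding m2_coboundaries_eq by blast
next
  fix c :: 'k and v :: "'k m2_cochain" assume "v \<in> m2_coboundaries l"
  then obtain a where "v = (\<lambda>y. m2_scale a (m2_bracket (m2_e l) y))"
    unfolding m2_coboundaries_eq by blast
  then have "c \<odot>\<^bsub>m2_cocycle_space l\<^esub> v = (\<lambda>y. m2_scale (c * a) (m2_bracket (m2_e l) y))"
    by (simp add: m2_cocycle_space_def)
  then show "c \<odot>\<^bsub>m2_cocycle_space l\<^esub> v \<in> m2_coboundaries l"
    unfolding m2_coboundaries_eq by blast
qed

lemma module_quotient_module:
  assumes "submodule R N M"
  shows "Module.module R (quotient_module M N)"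
    and "\<And>c x. c \<in> carrier R \<Longrightarrow> x \<in> carrier M \<Longrightarrow>
           c \<odot>\<^bsub>quotient_module M N\<^esub> (N +>\<^bsub>M\<^esub> x) = N +>\<^bsub>M\<^esub> (c \<odot>\<^bsub>M\<^esub> x)"
proof -
  interpret submodule R N M by fact
  interpret M: Module.module R M by (rule module)
  let ?Q = "quotient_module M N"
  have "subgroup N (add_monoid M)"
  proof (rule M.add.subgroupI)
    fix a assume a: "a \<in> N"
    then have "\<ominus>\<^bsub>M\<^esub> a = (\<ominus>\<^bsub>R\<^esub> \<one>\<^bsub>R\<^esub>) \<odot>\<^bsub>M\<^esub> a"
      using subset by (metis M.R.one_closed M.smult_l_minus M.smult_one subsetD)
    then show "\<ominus>\<^bsub>M\<^esub> a \<in> N" using a by simp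
  next
    show "N \<noteq> {}" using zero_closed by blast
  qed (use subset in auto)
  then interpret abelian_subgroup N M
    by (intro abelian_subgroupI3 additive_subgroupI M.abelian_group_axioms)
  show smult: "c \<odot>\<^bsub>?Q\<^esub> (N +>\<^bsub>M\<^esub> x) = N +>\<^bsub>M\<^esub> (c \<odot>\<^bsub>M\<^esub> x)"
    if c: "c \<in> carrier R" and x: "x \<in> carrier M" for c x
  proof -
    have "N +>\<^bsub>M\<^esub> (c \<odot>\<^bsub>M\<^esub> y) = N +>\<^bsub>M\<^esub> (c \<odot>\<^bsub>M\<^esub> x)" if y: "y \<in> N +>\<^bsub>M\<^esub> x" for y
    proof -
      from y obtain h where h: "h \<in> N" "y = h \<oplus>\<^bsub>M\<^esub> x"
        by (auto simp: a_r_coset_def')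
      then have "c \<odot>\<^bsub>M\<^esub> y = c \<odot>\<^bsub>M\<^esub> h \<oplus>\<^bsub>M\<^esub> c \<odot>\<^bsub>M\<^esub> x"
        using c x subset by (auto intro: M.smult_r_distr)
      then have "c \<odot>\<^bsub>M\<^esub> y \<in> N +>\<^bsub>M\<^esub> (c \<odot>\<^bsub>M\<^esub> x)"
        using c h by (auto simp: a_r_coset_def')
      with c x show ?thesis
        by (metis a_repr_independence' M.smult_closed)
    qed
    then have "(\<Union>y\<in>N +>\<^bsub>M\<^esub> x. N +>\<^bsub>M\<^esub> (c \<odot>\<^bsub>M\<^esub> y)) =
        (\<Union>y\<in>N +>\<^bsub>M\<^esub> x. N +>\<^bsub>M\<^esub> (c \<odot>\<^bsub>M\<^esub> x))"
      by (rule SUP_cong[OF refl])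
    also have "\<dots> = N +>\<^bsub>M\<^esub> (c \<odot>\<^bsub>M\<^esub> x)"
      using a_rcos_self[OF x] by blast
    finally show ?thesis
      by (simp only: quotient_module_def module.simps)
  qed
  have carrier: "X \<in> carrier ?Q \<longleftrightarrow> (\<exists>x\<in>carrier M. X = N +>\<^bsub>M\<^esub> x)" for X
    by (auto simp: quotient_module_def A_RCOSETS_def')
  have add: "(N +>\<^bsub>M\<^esub> x) \<oplus>\<^bsub>?Q\<^esub> (N +>\<^bsub>M\<^esub> y) = N +>\<^bsub>M\<^esub> (x \<oplus>\<^bsub>M\<^esub> y)"
    if "x \<in> carrier M" "y \<in> carrier M" for x y
    using that by (simp add: quotient_module_def a_rcos_sum)
  have zero: "\<zero>\<^bsub>?Q\<^esub> = N +>\<^bsub>M\<^esub> \<zero>\<^bsub>M\<^esub>"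
    using subset by (simp add: quotient_module_def M.a_coset_add_zero)
  have ab: "abelian_group ?Q"
  proof (rule abelian_groupI)
    fix X Y assume "X \<in> carrier ?Q" "Y \<in> carrier ?Q"
    then show "X \<oplus>\<^bsub>?Q\<^esub> Y \<in> carrier ?Q"
      unfolding carrier using add M.add.m_closed by metis
  next
    show "\<zero>\<^bsub>?Q\<^esub> \<in> carrier ?Q"
      unfolding carrier zero by blast
  next
    fix X Y Z assume "X \<in> carrier ?Q" "Y \<in> carrier ?Q" "Z \<in> carrier ?Q"
    then show "X \<oplus>\<^bsub>?Q\<^esub> Y \<oplus>\<^bsub>?Q\<^esub> Z = X \<oplus>\<^bsub>?Q\<^esub> (Y \<oplus>\<^bsub>?Q\<^esub> Z)"
      unfolding carrier by (elim bexE) (simp add: add M.a_assoc)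
  next
    fix X Y assume "X \<in> carrier ?Q" "Y \<in> carrier ?Q"
    then show "X \<oplus>\<^bsub>?Q\<^esub> Y = Y \<oplus>\<^bsub>?Q\<^esub> X"
      unfolding carrier by (elim bexE) (simp add: add M.a_comm)
  next
    fix X assume "X \<in> carrier ?Q"
    then show "\<zero>\<^bsub>?Q\<^esub> \<oplus>\<^bsub>?Q\<^esub> X = X"
      unfolding carrier zero by (elim bexE) (simp add: add)
  next
    fix X assume "X \<in> carrier ?Q"
    then obtain x where x: "x \<in> carrier M" "X = N +>\<^bsub>M\<^esub> x" unfolding carrier by blast
    then have "(N +>\<^bsub>M\<^esub> (\<ominus>\<^bsub>M\<^esub> x)) \<oplus>\<^bsub>?Q\<^esub> X = \<zero>\<^bsub>?Q\<^esub>"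
      by (simp add: add zero M.l_neg)
    moreover have "N +>\<^bsub>M\<^esub> (\<ominus>\<^bsub>M\<^esub> x) \<in> carrier ?Q"
      unfolding carrier using x M.a_inv_closed by blast
    ultimately show "\<exists>Y\<in>carrier ?Q. Y \<oplus>\<^bsub>?Q\<^esub> X = \<zero>\<^bsub>?Q\<^esub>"
      by blast
  qed
  show "Module.module R ?Q"
  proof (rule moduleI[OF M.R.is_cring ab])
    fix a X assume "a \<in> carrier R" "X \<in> carrier ?Q"
    then show "a \<odot>\<^bsub>?Q\<^esub> X \<in> carrier ?Q"
      unfolding carrier using smult by fastforce
  next
    fix a b X assume "a \<in> carrier R" "b \<in> carrier R" "X \<in> carrier ?Q"
    then show "(a \<oplus>\<^bsub>R\<^esub> b) \<odot>\<^bsub>?Q\<^esub> X = a \<odot>\<^bsub>?Q\<^esub> X \<oplus>\<^bsub>?Q\<^esub> b \<odot>\<^bsub>?Q\<^esub> X"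
      unfolding carrier by (elim bexE) (simp add: smult add M.smult_l_distr)
  next
    fix a X Y assume "a \<in> carrier R" "X \<in> carrier ?Q" "Y \<in> carrier ?Q"
    then show "a \<odot>\<^bsub>?Q\<^esub> (X \<oplus>\<^bsub>?Q\<^esub> Y) = a \<odot>\<^bsub>?Q\<^esub> X \<oplus>\<^bsub>?Q\<^esub> a \<odot>\<^bsub>?Q\<^esub> Y"
      unfolding carrier by (elim bexE) (simp add: smult add M.smult_r_distr)
  next
    fix a b X assume "a \<in> carrier R" "b \<in> carrier R" "X \<in> carrier ?Q"
    then show "(a \<otimes>\<^bsub>R\<^esub> b) \<odot>\<^bsub>?Q\<^esub> X = a \<odot>\<^bsub>?Q\<^esub> (b \<odot>\<^bsub>?Q\<^esub> X)"
      unfolding carrier by (elim bexE) (simp add: smult M.smult_assoc1)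
  next
    fix X assume "X \<in> carrier ?Q"
    then show "\<one>\<^bsub>R\<^esub> \<odot>\<^bsub>?Q\<^esub> X = X"
      unfolding carrier by (elim bexE) (simp add: smult)
  qed
qed

lemma vectorspace_m2_H1: "vectorspace class_ring (m2_H1 l :: ('k::field, 'k m2_cochain set) module)"
  unfolding vectorspace_def m2_H1_def
  by (simp add: class_field module_quotient_module(1)[OF submodule_m2_coboundaries])

end

theory Submission
  imports Defs
begin

text \<open>
  The Lie algebra is generated by \<open>e 1\<close> and \<open>e 2\<close>, so a derivation is determined by its values
  there (\<open>m2_cocycle_eqI\<close>); a derivation of weight \<open>l\<close> is thus given by two scalars \<open>a, b\<close> with
  \<open>e 1 \<mapsto> a e (1 + l)\<close> and \<open>e 2 \<mapsto> b e (2 + l)\<close>. They are restricted by the relation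
  \<open>[e 1, e 4] = e 5 = [e 2, e 3]\<close>, where \<open>e 3 = [e 1, e 2]\<close> and \<open>e 4 = [e 1, e 3]\<close>; applying a
  derivation to both sides gives \<open>m2_cocycle_relation\<close>. It has the following consequences.

  \<^item> For \<open>l \<le> -2\<close> both values vanish for reasons of degree, and for \<open>l = -1\<close> the relation forces
    \<open>b = 0\<close> while \<open>e 0 = 0\<close>. There are no nonzero derivations.
  \<^item> For \<open>l = 0\<close> it forces \<open>b = 2 a\<close>, so the derivations are the multiples of the degree
    derivation \<open>e i \<mapsto> i e i\<close>. There are no nonzero inner ones.
  \<^item> For \<open>l = 1\<close> it forces \<open>2 a = 0\<close>, so in characteristic different from 2 only the multiples of
    \<open>[e 1, -]\<close> remain, and these are inner.
  \<^item> For \<open>l \<ge> 2\<close> it is vacuous. Besides \<open>[e l, -]\<close>, which does not kill \<open>e 1\<close>, there is the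
    derivation that kills \<open>e 1\<close> and maps \<open>e i\<close> to \<open>e (i + l)\<close> for \<open>i \<ge> 2\<close>. These two span, and only
    the multiples of the former are inner.

  So either every cocycle is a coboundary, or the coboundaries together with one cocycle outside
  them span the space; the quotient has dimension 0 or 1 accordingly.
\<close>

section \<open>Quotients of dimension at most one\<close>

lemma submodule_imp_abelian_subgroup:
  assumes "submodule R N M"
  shows "abelian_subgroup N M"
proof -
  interpret submodule R N M by fact
  interpret M: Module.module R M by (rule module)
  have "subgroup N (add_monoid M)"
  proof (rule M.add.subgroupI)
    fix a assume a: "a \<in> N"
    then have "\<ominus>\<^bsub>M\<^esub> a = (\<ominus>\<^bsub>R\<^esub> \<one>\<^bsub>R\<^esub>) \<odot>\<^bsub>M\<^esub> a"
      using subset by (metis M.R.one_closed M.smult_l_minus M.smult_one subsetD)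
    then show "\<ominus>\<^bsub>M\<^esub> a \<in> N" using a by simp
  next
    show "N \<noteq> {}" using zero_closed by blast
  qed (use subset in auto)
  then show ?thesis
    by (intro abelian_subgroupI3 additive_subgroupI M.abelian_group_axioms)
qed

lemma (in vectorspace) fin_dim_dim_zeroI:
  assumes "carrier V = {\<zero>\<^bsub>V\<^esub>}"
  shows "fin_dim \<and> dim = 0"
proof -
  have "gen_set {\<zero>\<^bsub>V\<^esub>}"
    using assms in_own_span[of "{\<zero>\<^bsub>V\<^esub>}"] span_is_subset2[of "{\<zero>\<^bsub>V\<^esub>}"] by auto
  then show ?thesis
    using dim0I unfolding fin_dim_def by (intro conjI exI[of _ "{\<zero>\<^bsub>V\<^esub>}"]) auto
qed

lemma (in vectorspace) fin_dim_dim_oneI: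
  assumes v: "v \<in> carrier V" "v \<noteq> \<zero>\<^bsub>V\<^esub>"
    and gen: "\<And>x. x \<in> carrier V \<Longrightarrow> \<exists>c\<in>carrier K. x = c \<odot>\<^bsub>V\<^esub> v"
  shows "fin_dim \<and> dim = 1"
proof -
  have sub: "submodule K (span {v}) V"
    using v by (intro span_is_submodule) auto
  have "v \<in> span {v}"
    using v in_own_span[of "{v}"] by auto
  then have "carrier V \<subseteq> span {v}"
    using gen submodule.smult_closed[OF sub] by blast
  then have "gen_set {v}"
    using v span_is_subset2[of "{v}"] by auto
  then show ?thesis
    using dim1I v unfolding fin_dim_def by (intro conjI exI[of _ "{v}"]) auto
qed

lemma quotient_module_dim_zero:
  assumes "vectorspace K M" and sub: "submodule K N M" and all: "carrier M \<subseteq> N"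
  shows "vectorspace.fin_dim K (quotient_module M N) \<and> vectorspace.dim K (quotient_module M N) = 0"
proof -
  interpret vectorspace K M by fact
  interpret N: abelian_subgroup N M
    by (rule submodule_imp_abelian_subgroup[OF sub])
  interpret Q: vectorspace K "quotient_module M N"
    by (simp add: vectorspace_def module_quotient_module(1)[OF sub] field_axioms)
  have "N +>\<^bsub>M\<^esub> x = N" if "x \<in> carrier M" for x
    using that all N.a_rcos_const by blast
  then have "(\<Union>x\<in>carrier M. {N +>\<^bsub>M\<^esub> x}) = {N}"
    using M.zero_closed by blast
  then have "carrier (quotient_module M N) = {\<zero>\<^bsub>quotient_module M N\<^esub>}"
    by (simp only: quotient_module_def A_RCOSETS_def' partial_object.simps ring.simps monoid.simps)
  then show ?thesis by (rule Q.fin_dim_dim_zeroI)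
qed

lemma quotient_module_dim_one:
  assumes "vectorspace K M" and sub: "submodule K N M"
    and v: "v \<in> carrier M" "v \<notin> N"
    and gen: "\<And>x. x \<in> carrier M \<Longrightarrow> \<exists>n\<in>N. \<exists>c\<in>carrier K. x = n \<oplus>\<^bsub>M\<^esub> c \<odot>\<^bsub>M\<^esub> v"
  shows "vectorspace.fin_dim K (quotient_module M N) \<and> vectorspace.dim K (quotient_module M N) = 1"
proof -
  interpret vectorspace K M by fact
  interpret N: abelian_subgroup N M
    by (rule submodule_imp_abelian_subgroup[OF sub])
  let ?Q = "quotient_module M N"
  interpret Q: vectorspace K ?Q
    by (simp add: vectorspace_def module_quotient_module(1)[OF sub] field_axioms)
  show ?thesis
  proof (rule Q.fin_dim_dim_oneI)
    show "N +>\<^bsub>M\<^esub> v \<in> carrier ?Q"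
      using v by (auto simp: quotient_module_def A_RCOSETS_def')
    show "N +>\<^bsub>M\<^esub> v \<noteq> \<zero>\<^bsub>?Q\<^esub>"
      using v N.a_rcos_self by (auto simp: quotient_module_def)
  next
    fix X assume "X \<in> carrier ?Q"
    then obtain x where x: "x \<in> carrier M" "X = N +>\<^bsub>M\<^esub> x"
      by (auto simp: quotient_module_def A_RCOSETS_def')
    then obtain n c where n: "n \<in> N" and c: "c \<in> carrier K" and eq: "x = n \<oplus>\<^bsub>M\<^esub> c \<odot>\<^bsub>M\<^esub> v"
      using gen by blast
    have "x \<in> N +>\<^bsub>M\<^esub> (c \<odot>\<^bsub>M\<^esub> v)"
      using n by (auto simp: eq a_r_coset_def')
    then have "X = N +>\<^bsub>M\<^esub> (c \<odot>\<^bsub>M\<^esub> v)"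
      using x c v by (metis N.a_repr_independence' smult_closed)
    also have "\<dots> = c \<odot>\<^bsub>?Q\<^esub> (N +>\<^bsub>M\<^esub> v)"
      using module_quotient_module(2)[OF sub c v(1)] by simp
    finally show "\<exists>c\<in>carrier K. X = c \<odot>\<^bsub>?Q\<^esub> (N +>\<^bsub>M\<^esub> v)"
      using c by blast
  qed
qed


section \<open>Derivations and their values on the generators\<close>

lemma m2_cocycle_linear:
  assumes "\<omega> \<in> m2_cocycles l"
  shows "\<omega> (x + y) = \<omega> x + \<omega> y" "\<omega> (m2_scale c x) = m2_scale c (\<omega> x)"
  using assms by (auto simp: m2_cocycles_def m2_cochains_def linear_m2_iff)

lemma m2_cocycle_Leibniz:
  assumes "\<omega> \<in> m2_cocycles l"
  shows "\<omega> (m2_bracket x y) = m2_bracket (\<omega> x) y + m2_bracket x (\<omega> y)"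
  using assms by (auto simp: m2_cocycles_def)

lemma lookup_m2_e: "Poly_Mapping.lookup (m2_e k) n = (if k = int n + 1 then 1 else 0)"
  by (auto simp: m2_e_def lookup_single when_def)

lemma m2_scale_e_eq_zero_iff: "k \<ge> 1 \<Longrightarrow> m2_scale a (m2_e k) = 0 \<longleftrightarrow> a = 0"
  using arg_cong[of "m2_scale a (m2_e k)" 0 "\<lambda>x. Poly_Mapping.lookup x (nat (k - 1))"]
  by (auto simp: lookup_m2_e)

text \<open>
  \<open>e 1\<close> and \<open>e 2\<close> generate: \<open>e (i + 1) = [e 1, e i]\<close> for \<open>i \<ge> 2\<close>, so by the Leibniz rule agreement
  passes from \<open>e i\<close> to \<open>e (i + 1)\<close>.
\<close>

lemma m2_cocycle_eqI:
  assumes \<phi>: "\<phi> \<in> m2_cocycles l" and \<psi>: "\<psi> \<in> m2_cocycles l"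
    and "\<phi> (m2_e 1) = \<psi> (m2_e 1)" "\<phi> (m2_e 2) = \<psi> (m2_e 2)"
  shows "\<phi> = \<psi>"
proof
  have ge2: "\<phi> (m2_e i) = \<psi> (m2_e i)" if "i \<ge> 2" for i
    using that
  proof (induction i rule: int_ge_induct)
    case (step i)
    then have "m2_e (i + 1) = m2_bracket (m2_e 1) (m2_e i :: 'a m2)"
      by (simp add: m2_bracket_e m2_basis_bracket_def)
    then show ?case
      using step assms by (simp add: m2_cocycle_Leibniz)
  qed (use assms in auto)
  fix x
  show "\<phi> x = \<psi> x"
  proof (induction x rule: m2_induct)
    case zero
    then show ?case
      using m2_cocycle_linear(2)[OF \<phi>, of 0] m2_cocycle_linear(2)[OF \<psi>, of 0] by simp
  next
    case (e i)
    then have "i = 1 \<or> i \<ge> 2" by linarith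
    then show ?case using assms ge2 by auto
  qed (simp_all add: m2_cocycle_linear[OF \<phi>] m2_cocycle_linear[OF \<psi>])
qed

lemma m2_cocycle_on_generators:
  assumes \<omega>: "\<omega> \<in> m2_cocycles l"
  obtains a b where "\<omega> (m2_e 1) = m2_scale a (m2_e (1 + l))"
    "\<omega> (m2_e 2) = m2_scale b (m2_e (2 + l))"
proof -
  have "m2_homogeneous l \<omega>"
    using \<omega> by (simp add: m2_cocycles_def)
  then show ?thesis
    unfolding m2_homogeneous_def by (meson one_le_numeral order_refl that)
qed

text \<open>
  The two sides are the Leibniz expansions of \<open>\<omega> [e 1, [e 1, [e 1, e 2]]]\<close> and \<open>\<omega> [e 2, [e 1, e 2]]\<close>,
  both of which are \<open>\<omega> (e 5)\<close>. Only the values on the generators occur.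
\<close>

lemma m2_cocycle_relation:
  fixes \<omega> :: "'k::field m2_cochain"
  assumes \<omega>: "\<omega> \<in> m2_cocycles l"
  defines "u \<equiv> \<omega> (m2_e 1)" and "v \<equiv> \<omega> (m2_e 2)"
  shows "m2_bracket u (m2_e 4) + m2_bracket (m2_e 1) (m2_bracket u (m2_e 3)
           + m2_bracket (m2_e 1) (m2_bracket u (m2_e 2) + m2_bracket (m2_e 1) v))
       = m2_bracket v (m2_e 3) + m2_bracket (m2_e 2) (m2_bracket u (m2_e 2) + m2_bracket (m2_e 1) v)"
proof -
  have e: "m2_bracket (m2_e 1) (m2_e 2) = (m2_e 3 :: 'k m2)"
    "m2_bracket (m2_e 1) (m2_e 3) = (m2_e 4 :: 'k m2)"
    "m2_bracket (m2_e 1) (m2_e 4) = (m2_e 5 :: 'k m2)"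
    "m2_bracket (m2_e 2) (m2_e 3) = (m2_e 5 :: 'k m2)"
    by (simp_all add: m2_bracket_e m2_basis_bracket_def)
  show ?thesis
    unfolding u_def v_def using e m2_cocycle_Leibniz[OF \<omega>] by metis
qed

text \<open>
  The defect of the Leibniz rule is bilinear and alternating, so it suffices to test it on ordered
  pairs of basis vectors.
\<close>

lemma m2_cocycleI:
  fixes \<omega> :: "'k::field m2_cochain"
  assumes lin: "Vector_Spaces.linear m2_scale m2_scale \<omega>"
    and hom: "m2_homogeneous l \<omega>"
    and Leibniz: "\<And>i j. 1 \<le> i \<Longrightarrow> i < j \<Longrightarrow>
      \<omega> (m2_bracket (m2_e i) (m2_e j)) = m2_bracket (\<omega> (m2_e i)) (m2_e j) + m2_bracket (m2_e i) (\<omega> (m2_e j))"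
  shows "\<omega> \<in> m2_cocycles l"
proof -
  have add: "\<omega> (x + y) = \<omega> x + \<omega> y" and scale: "\<omega> (m2_scale c x) = m2_scale c (\<omega> x)" for x y c
    using lin by (auto simp: linear_m2_iff)
  have zero: "\<omega> 0 = 0" using scale[of 0 0] by simp
  have minus: "\<omega> (- x) = - \<omega> x" for x
    using scale[of "-1" x] by simp
  have on_basis: "\<omega> (m2_bracket (m2_e i) (m2_e j)) = m2_bracket (\<omega> (m2_e i)) (m2_e j) + m2_bracket (m2_e i) (\<omega> (m2_e j))"
    if "1 \<le> i" "1 \<le> j" for i j
  proof (cases i j rule: linorder_cases)
    case less
    with that Leibniz show ?thesis by blast
  next
    case equal
    then show ?thesis
      using m2_bracket_antisym[of "m2_e i" "\<omega> (m2_e i)"] by (simp add: m2_bracket_self_zero zero)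
  next
    case greater
    then show ?thesis
      using that Leibniz[of j i] minus[of "m2_bracket (m2_e j) (m2_e i)"]
        m2_bracket_antisym[of "\<omega> (m2_e i)" "m2_e j"] m2_bracket_antisym[of "m2_e i" "\<omega> (m2_e j)"]
      by (simp add: m2_bracket_antisym[of "m2_e i" "m2_e j"])
  qed
  note s = add scale zero m2_bracket_add_left m2_bracket_add_right m2_bracket_scale_left
    m2_bracket_scale_right m2.scale_right_distrib ac_simps
  have "\<omega> (m2_bracket x y) = m2_bracket (\<omega> x) y + m2_bracket x (\<omega> y)" for x y
  proof (induction x rule: m2_induct)
    case (e i) note i = this
    show ?case
    proof (induction y rule: m2_induct)
      case (e j)
      then show ?case using i on_basis by simp
    qed (auto simp: s)
  qed (auto simp: s)
  then show ?thesis
    using lin hom by (simp add: m2_cocycles_def m2_cochains_def)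
qed


section \<open>The non-inner derivations\<close>

text \<open>The linear extension of \<open>e i \<mapsto> a i e (i + l)\<close>.\<close>

definition m2_diagonal :: "int \<Rightarrow> (int \<Rightarrow> 'k) \<Rightarrow> 'k::field m2_cochain" where
  "m2_diagonal l a x =
     (\<Sum>n\<in>Poly_Mapping.keys x.
        m2_scale (Poly_Mapping.lookup x n * a (int n + 1)) (m2_e (int n + 1 + l)))"

lemma m2_diagonal_superset:
  assumes "finite A" "Poly_Mapping.keys x \<subseteq> A"
  shows "m2_diagonal l a x =
    (\<Sum>n\<in>A. m2_scale (Poly_Mapping.lookup x n * a (int n + 1)) (m2_e (int n + 1 + l)))"
  unfolding m2_diagonal_def using assms
  by (intro sum.mono_neutral_left) (auto simp: in_keys_iff)

lemma linear_m2_diagonal: "Vector_Spaces.linear m2_scale m2_scale (m2_diagonal l a)"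
  unfolding linear_m2_iff
proof (intro conjI allI)
  fix x y :: "'a m2"
  let ?A = "Poly_Mapping.keys x \<union> Poly_Mapping.keys y"
  have "Poly_Mapping.keys (x + y) \<subseteq> ?A" by (rule keys_add)
  then show "m2_diagonal l a (x + y) = m2_diagonal l a x + m2_diagonal l a y"
    by (subst (1 2 3) m2_diagonal_superset[where A = ?A])
       (auto simp: lookup_add distrib_right m2.scale_left_distrib sum.distrib)
next
  fix c :: 'a and x :: "'a m2"
  have "Poly_Mapping.keys (m2_scale c x) \<subseteq> Poly_Mapping.keys x"
    by (auto simp: in_keys_iff)
  then show "m2_diagonal l a (m2_scale c x) = m2_scale c (m2_diagonal l a x)"
    by (subst (1 2) m2_diagonal_superset[where A = "Poly_Mapping.keys x"])
       (auto simp: m2.scale_sum_right mult.assoc)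
qed

lemma m2_diagonal_e: "i \<ge> 1 \<Longrightarrow> m2_diagonal l a (m2_e i) = m2_scale (a i) (m2_e (i + l))"
  by (simp add: m2_diagonal_def m2_e_def)

lemma m2_diagonal_zero: "m2_diagonal l a 0 = 0"
  by (simp add: m2_diagonal_def)

lemma m2_homogeneous_diagonal: "m2_homogeneous l (m2_diagonal l a)"
  unfolding m2_homogeneous_def using m2_diagonal_e by blast

lemma m2_index_cases:
  assumes "1 \<le> i" "i < (j::int)"
  obtains "i = 1" "j = 2" | "i = 1" "j \<ge> 3" | "i = 2" "j \<ge> 3" | "i \<ge> 3" "j \<ge> 3"
  using assms by force

text \<open>The derivation that belongs to the grading: it multiplies \<open>e i\<close> by its degree \<open>i\<close>.\<close>

abbreviation m2_degree :: "'k::field m2_cochain" where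
  "m2_degree \<equiv> m2_diagonal 0 of_int"

lemma m2_degree_cocycle: "m2_degree \<in> m2_cocycles 0"
proof (rule m2_cocycleI[OF linear_m2_diagonal m2_homogeneous_diagonal])
  fix i j :: int assume "1 \<le> i" "i < j"
  moreover have "m2_scale 3 x = x + m2_scale 2 x" for x :: "'a m2"
    using m2.scale_left_distrib[of 1 2 x] by simp
  ultimately show "m2_degree (m2_bracket (m2_e i) (m2_e j)) =
      m2_bracket (m2_degree (m2_e i)) (m2_e j) + m2_bracket (m2_e i) (m2_degree (m2_e j) :: 'a m2)"
    by (elim m2_index_cases)
       (simp_all add: m2_diagonal_e m2_bracket_scale_left m2_bracket_scale_right m2_bracket_e
         m2_basis_bracket_def m2_diagonal_zero m2.scale_left_distrib)
qed

abbreviation m2_truncated_shift :: "int \<Rightarrow> 'k::field m2_cochain" where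
  "m2_truncated_shift l \<equiv> m2_diagonal l (\<lambda>i. if i = 1 then 0 else 1)"

text \<open>
  The Leibniz rule reduces to the shift commuting with \<open>[e 1, -]\<close> and \<open>[e 2, -]\<close>, which it does where
  these raise the index by 1 and by 2: the remaining terms vanish, as \<open>e 1\<close> is sent to 0 and every
  other \<open>e i\<close> into the span of the \<open>e j\<close> with \<open>j \<ge> 3\<close>, whose brackets with each other are 0.
\<close>

lemma m2_truncated_shift_cocycle:
  assumes "l \<ge> 1"
  shows "m2_truncated_shift l \<in> m2_cocycles l"
proof (rule m2_cocycleI[OF linear_m2_diagonal m2_homogeneous_diagonal])
  fix i j :: int assume "1 \<le> i" "i < j"
  then show "m2_truncated_shift l (m2_bracket (m2_e i) (m2_e j)) =
      m2_bracket (m2_truncated_shift l (m2_e i)) (m2_e j)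
      + m2_bracket (m2_e i) (m2_truncated_shift l (m2_e j) :: 'a m2)"
    using assms
    by (cases rule: m2_index_cases)
       (simp_all add: m2_diagonal_e m2_bracket_scale_left m2_bracket_scale_right m2_bracket_e
         m2_basis_bracket_def m2_diagonal_zero ac_simps)
qed


section \<open>Cocycles modulo coboundaries\<close>

lemma m2_inner_cocycle: "(\<lambda>y. m2_scale c (m2_bracket (m2_e l) y)) \<in> m2_cocycles l"
  using m2_coboundaries_subset_cocycles m2_coboundaries_eq by blast

lemma m2_cocycle_weight_neg:
  assumes \<omega>: "\<omega> \<in> m2_cocycles l" and l: "l \<le> -1"
  shows "\<omega> = (\<lambda>_. 0)"
proof -
  obtain a b where a: "\<omega> (m2_e 1) = m2_scale a (m2_e (1 + l))"
    and b: "\<omega> (m2_e 2) = m2_scale b (m2_e (2 + l))"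
    using m2_cocycle_on_generators[OF \<omega>] by blast
  have "m2_scale b (m2_e (2 + l)) = 0"
  proof (cases "l = -1")
    case True
    (* here e 1 is sent to 0 and e 2 to b e 1, which commutes with e 1: only [b e 1, e 3] survives *)
    have "m2_scale b (m2_e 4) = 0"
      using m2_cocycle_relation[OF \<omega>]
      by (simp add: a b True m2_bracket_scale_left m2_bracket_scale_right m2_bracket_e m2_basis_bracket_def)
    then show ?thesis using m2_scale_e_eq_zero_iff[of 4 b] by simp
  qed (use l in auto)
  then show ?thesis
    using a b l by (intro m2_cocycle_eqI[OF \<omega> zero_in_m2_cocycles]) auto
qed

lemma m2_cocycle_weight_zero:
  assumes \<omega>: "\<omega> \<in> m2_cocycles 0"
  obtains c where "\<omega> = (\<lambda>x. m2_scale c (m2_degree x))"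
proof -
  obtain a b where a: "\<omega> (m2_e 1) = m2_scale a (m2_e 1)"
    and b: "\<omega> (m2_e 2) = m2_scale b (m2_e 2)"
    using m2_cocycle_on_generators[OF \<omega>] by auto
  (* the coefficient of e 5 has index 4 *)
  have "a + (a + (a + b)) = b + (a + b)"
    (* the vectors also carry a ring structure; without this, x + x would become the product 2 * x,
       about which the bracket knows nothing *)
    using [[simproc del: int_combine_numerals]]
    using arg_cong[OF m2_cocycle_relation[OF \<omega>], of "\<lambda>x. Poly_Mapping.lookup x 4"]
    by (simp add: a b m2_bracket_scale_left m2_bracket_scale_right m2_bracket_add_right
        m2_bracket_e m2_basis_bracket_def lookup_add lookup_m2_e)
  then have "b = a * 2" by (simp add: algebra_simps)
  then have "\<omega> = (\<lambda>x. m2_scale a (m2_degree x))"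
    using a b
    by (intro m2_cocycle_eqI[OF \<omega> scale_in_m2_cocycles[OF m2_degree_cocycle]])
       (simp_all add: m2_diagonal_e)
  then show ?thesis by (rule that)
qed

lemma m2_cocycle_weight_one:
  assumes \<omega>: "\<omega> \<in> m2_cocycles 1" and char: "(2::'k::field) \<noteq> 0"
  shows "\<omega> \<in> (m2_coboundaries 1 :: 'k m2_cochain set)"
proof -
  obtain a b where a: "\<omega> (m2_e 1) = m2_scale a (m2_e 2)"
    and b: "\<omega> (m2_e 2) = m2_scale b (m2_e 3)"
    using m2_cocycle_on_generators[OF \<omega>] by auto
  (* the coefficient of e 6 has index 5 *)
  have "a + (a + b) = b"
    using [[simproc del: int_combine_numerals]]
    using arg_cong[OF m2_cocycle_relation[OF \<omega>], of "\<lambda>x. Poly_Mapping.lookup x 5"]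
    by (simp add: a b m2_bracket_scale_left m2_bracket_scale_right m2_bracket_add_right
        m2_bracket_e m2_basis_bracket_def lookup_add lookup_m2_e)
  then have "2 * a = 0" by (simp add: algebra_simps)
  then have "a = 0" using char by simp
  then have "\<omega> = (\<lambda>y. m2_scale b (m2_bracket (m2_e 1) y))"
    using a b
    by (intro m2_cocycle_eqI[OF \<omega> m2_inner_cocycle])
       (simp_all add: m2_bracket_e m2_basis_bracket_def)
  then show ?thesis unfolding m2_coboundaries_eq by blast
qed

text \<open>
  The multiple of \<open>[e l, -]\<close> is chosen to match the value at \<open>e 1\<close>, which the truncated shift kills;
  the multiple of the shift then corrects the value at \<open>e 2\<close>.
\<close>

lemma m2_cocycle_weight_ge_two:
  fixes \<omega> :: "'k::field m2_cochain"
  assumes \<omega>: "\<omega> \<in> m2_cocycles l" and l: "l \<ge> 2"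
  obtains \<phi> c where "\<phi> \<in> m2_coboundaries l"
    "\<omega> = (\<lambda>x. \<phi> x + m2_scale c (m2_truncated_shift l x))"
proof -
  obtain a b where a: "\<omega> (m2_e 1) = m2_scale a (m2_e (1 + l))"
    and b: "\<omega> (m2_e 2) = m2_scale b (m2_e (2 + l))"
    using m2_cocycle_on_generators[OF \<omega>] by blast
  define \<phi> :: "'k m2_cochain" where "\<phi> = (\<lambda>y. m2_scale (- a) (m2_bracket (m2_e l) y))"
  (* [e l, e 2] is - e (l + 2), except that [e 2, e 2] = 0 *)
  define c where "c = (if l = 2 then b else b - a)"
  have \<phi>: "\<phi> \<in> m2_coboundaries l"
    unfolding \<phi>_def m2_coboundaries_eq by blast
  have "m2_truncated_shift l \<in> (m2_cocycles l :: 'k m2_cochain set)"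
    using l by (intro m2_truncated_shift_cocycle) auto
  then have "(\<lambda>x. \<phi> x + m2_scale c (m2_truncated_shift l x)) \<in> m2_cocycles l"
    by (rule add_in_m2_cocycles[OF subsetD[OF m2_coboundaries_subset_cocycles \<phi>] scale_in_m2_cocycles])
  then have "\<omega> = (\<lambda>x. \<phi> x + m2_scale c (m2_truncated_shift l x))"
    using a b l
    by (intro m2_cocycle_eqI[OF \<omega>])
       (auto simp: \<phi>_def c_def m2_diagonal_e m2_bracket_e m2_basis_bracket_def
          m2.scale_left_diff_distrib ac_simps)
  with \<phi> show ?thesis by (rule that)
qed

lemma m2_degree_not_coboundary: "m2_degree \<notin> (m2_coboundaries 0 :: 'k::field m2_cochain set)"
proof
  assume "m2_degree \<in> (m2_coboundaries 0 :: 'k m2_cochain set)"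
  then have "m2_degree (m2_e 1 :: 'k m2) = 0"
    by (auto simp: m2_coboundaries_eq)
  then show False
    using m2_scale_e_eq_zero_iff[of 1 "1::'k"] by (simp add: m2_diagonal_e)
qed

text \<open>A multiple of \<open>[e l, -]\<close> that kills \<open>e 1\<close> is zero, but the shift does not kill \<open>e 2\<close>.\<close>

lemma m2_truncated_shift_not_coboundary:
  assumes l: "l \<ge> 2"
  shows "m2_truncated_shift l \<notin> (m2_coboundaries l :: 'k::field m2_cochain set)"
proof
  assume "m2_truncated_shift l \<in> (m2_coboundaries l :: 'k m2_cochain set)"
  then obtain c :: 'k where c: "m2_truncated_shift l = (\<lambda>y. m2_scale c (m2_bracket (m2_e l) y))"
    by (auto simp: m2_coboundaries_eq)
  have "m2_scale c (m2_e (l + 1)) = 0"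
    using fun_cong[OF c, of "m2_e 1"] l
    by (simp add: m2_diagonal_e m2_bracket_e m2_basis_bracket_def)
  then have "c = 0"
    using m2_scale_e_eq_zero_iff[of "l + 1" c] l by simp
  then have "m2_scale 1 (m2_e (2 + l)) = (0 :: 'k m2)"
    using fun_cong[OF c, of "m2_e 2"] by (simp add: m2_diagonal_e)
  then show False
    using m2_scale_e_eq_zero_iff[of "2 + l" "1::'k"] l by simp
qed

lemma m2_H1_dim:
  assumes char: "(2::'k::field) \<noteq> 0"
  shows "vectorspace.fin_dim class_ring (m2_H1 l :: ('k, 'k m2_cochain set) module) \<and>
    vectorspace.dim class_ring (m2_H1 l :: ('k, 'k m2_cochain set) module) =
      (if l = 1 \<or> l \<le> -1 then 0 else 1)"
proof -
  let ?B = "m2_coboundaries l :: 'k m2_cochain set"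
  note quotient = vectorspace_m2_cocycle_space submodule_m2_coboundaries
  have zero: "(\<lambda>_. 0) \<in> ?B"
    unfolding m2_coboundaries_eq by (auto intro: exI[of _ 0])
  show ?thesis
  proof (cases "l = 1 \<or> l \<le> -1")
    case True
    then have "m2_cocycles l \<subseteq> ?B"
      using m2_cocycle_weight_neg m2_cocycle_weight_one[OF _ char] zero by blast
    then show ?thesis
      using quotient_module_dim_zero[OF quotient] True
      by (simp add: m2_H1_def m2_cocycle_space_def)
  next
    case False
    then have l: "l = 0 \<or> l \<ge> 2" by linarith
    define \<delta> :: "'k m2_cochain"
      where "\<delta> = (if l = 0 then m2_degree else m2_truncated_shift l)"
    have "\<delta> \<in> m2_cocycles l"
      using l m2_degree_cocycle m2_truncated_shift_cocycle[of l] by (auto simp: \<delta>_def)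
    moreover have "\<delta> \<notin> ?B"
      using l m2_degree_not_coboundary m2_truncated_shift_not_coboundary by (auto simp: \<delta>_def)
    moreover have "\<exists>\<phi>\<in>?B. \<exists>c. \<omega> = (\<lambda>x. \<phi> x + m2_scale c (\<delta> x))"
      if \<omega>: "\<omega> \<in> m2_cocycles l" for \<omega>
    proof (cases "l = 0")
      case True
      with \<omega> have "\<omega> \<in> m2_cocycles 0" by simp
      then obtain c where "\<omega> = (\<lambda>x. m2_scale c (m2_degree x))"
        by (rule m2_cocycle_weight_zero)
      then show ?thesis
        by (intro bexI[OF _ zero] exI[of _ c]) (simp add: \<delta>_def True)
    next
      case False
      with l have "l \<ge> 2" by simp
      with \<omega> obtain \<phi> c where \<phi>: "\<phi> \<in> ?B"
        and "\<omega> = (\<lambda>x. \<phi> x + m2_scale c (m2_truncated_shift l x))"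
        by (rule m2_cocycle_weight_ge_two)
      then show ?thesis
        by (intro bexI[OF _ \<phi>] exI[of _ c]) (simp add: \<delta>_def False)
    qed
    ultimately show ?thesis
      using quotient_module_dim_one[OF quotient, of \<delta>] False
      by (simp add: m2_H1_def m2_cocycle_space_def)
  qed
qed

theorem theorem2:
  fixes l :: int
  shows
    "vectorspace.fin_dim class_ring (m2_H1 l :: (real, real m2_cochain set) module) \<and>
     vectorspace.dim class_ring (m2_H1 l :: (real, real m2_cochain set) module) =
       (if l = 1 \<or> l \<le> -1 then 0 else 1) \<and>
     vectorspace.fin_dim class_ring (m2_H1 l :: (complex, complex m2_cochain set) module) \<and>
     vectorspace.dim class_ring (m2_H1 l :: (complex, complex m2_cochain set) module) =
       (if l = 1 \<or> l \<le> -1 then 0 else 1)"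
proof -
  have R: "(2::real) \<noteq> 0" and C: "(2::complex) \<noteq> 0" by simp_all
  show ?thesis
    using m2_H1_dim[OF R, of l] m2_H1_dim[OF C, of l] by (elim conjE) (intro conjI; assumption)
qed

end
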